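(* Let $\mathcal{O}$ be a local principal ideal ring, complete with respect to its maximal ideal $\mathfrak{m}=(\pi)$, with residue field $k=\mathcal{O}/\mathfrak{m}$ of characteristic $\neq 2$, and let $m\geq 1$ be a positive integer. Suppose $k$ is large enough so that the $(m+1)$-th Engel map $\bar e_{m+1}\colon \mathfrak{sl}_2(k)\times \mathfrak{sl}_2(k)\to \mathfrak{sl}_2(k)$ is surjective. Then the $(m+1)$-th Engel map $e_{m+1}^{\mathcal{O}}\colon \mathfrak{sl}_2^{\circ}(\mathcal{O})\times \mathfrak{sl}_2^{\circ}(\mathcal{O})\to \mathfrak{sl}_2^{\circ}(\mathcal{O})$ is surjective.
   Context: Rings are commutative with unity. $\mathcal{O}$ is complete with respect to $\mathfrak{m}$ if the canonical map $\mathcal{O}\to\varprojlim_{j\ge 1}\mathcal{O}/\mathfrak{m}^j$ is an isomorphism. For a commutative ring $\mathcal{R}$ with unity, the Engel maps on $2\times 2$ matrices over $\mathcal{R}$ are defined by $e_1^{\mathcal{R}}(X,Y)=XY-YX$ and $e_{r+1}^{\mathcal{R}}(X,Y)=e_r^{\mathcal{R}}(X,Y)\,Y-Y\,e_r^{\mathcal{R}}(X,Y)$ for $r\ge 1$; write $\bar e_r=e_r^{k}$. Here $\mathfrak{sl}_2^{\circ}(\mathcal{O})=\{A\in \mathrm{M}_2(\mathcal{O})\mid \mathrm{tr}(A)=0\}$ and $\mathfrak{sl}_2(k)=\{A\in \mathrm{M}_2(k)\mid \mathrm{tr}(A)=0\}$. The formal hypothesis on $k$ is precisely the surjectivity of $\bar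 e_{m+1}$ on $\mathfrak{sl}_2(k)\times\mathfrak{sl}_2(k)$. *)

theory Defs
  imports "HOL-Algebra.QuotRing" "HOL-Algebra.Ideal_Product" "HOL-Algebra.Multiplicative_Group"
    "HOL-Analysis.Finite_Cartesian_Product"
begin

section \<open>Complete local principal ideal rings\<close>

locale local_ring = cring +
  assumes unique_maximal: "\<exists>!I. maximalideal I R"

text \<open>Zero divisors are allowed.\<close>

locale principal_ideal_ring = cring +
  assumes all_principal: "ideal I R \<Longrightarrow> principalideal I R"

text \<open>The powers of an ideal are its powers in the monoid of ideals under the ideal product.\<close>

abbreviation ideal_power :: "('a, 'b) ring_scheme \<Rightarrow> 'a set \<Rightarrow> nat \<Rightarrow> 'a set"
  where "ideal_power R I j \<equiv> I [^]\<^bsub>ideals_set R\<^esub> j"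

text \<open>
  The inverse limit of the rings \<open>R/I\<^sup>j\<close>, \<open>j \<ge> 1\<close>, with componentwise operations.
  For \<open>i \<le> j\<close> the transition map \<open>R/I\<^sup>j \<rightarrow> R/I\<^sup>i\<close> sends the coset \<open>X = I\<^sup>j + a\<close>
  to \<open>I\<^sup>i + a = I\<^sup>i + X\<close>.
\<close>

definition adic_limit :: "('a, 'b) ring_scheme \<Rightarrow> 'a set \<Rightarrow> (nat \<Rightarrow> 'a set) ring" where
  "adic_limit R I =
    \<lparr>carrier = {x \<in> (\<Pi>\<^sub>E j\<in>{1..}. carrier (R Quot ideal_power R I j)).
                  \<forall>i\<ge>1. \<forall>j\<ge>i. ideal_power R I i <+>\<^bsub>R\<^esub> x j = x i},
     mult = (\<lambda>x y. \<lambda>j\<in>{1..}. x j \<otimes>\<^bsub>R Quot ideal_power R I j\<^esub> y j),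
     one = (\<lambda>j\<in>{1..}. \<one>\<^bsub>R Quot ideal_power R I j\<^esub>),
     zero = (\<lambda>j\<in>{1..}. \<zero>\<^bsub>R Quot ideal_power R I j\<^esub>),
     add = (\<lambda>x y. \<lambda>j\<in>{1..}. x j \<oplus>\<^bsub>R Quot ideal_power R I j\<^esub> y j)\<rparr>"

definition to_adic_limit :: "('a, 'b) ring_scheme \<Rightarrow> 'a set \<Rightarrow> 'a \<Rightarrow> nat \<Rightarrow> 'a set" where
  "to_adic_limit R I a = (\<lambda>j\<in>{1..}. ideal_power R I j +>\<^bsub>R\<^esub> a)"

definition adically_complete :: "('a, 'b) ring_scheme \<Rightarrow> 'a set \<Rightarrow> bool" where
  "adically_complete R I \<longleftrightarrow> to_adic_limit R I \<in> ring_iso R (adic_limit R I)"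

text \<open>The characteristic is the additive order of \<open>1\<close>, which is \<open>0\<close> if that order is infinite.\<close>

definition ring_characteristic :: "('a, 'b) ring_scheme \<Rightarrow> nat" where
  "ring_characteristic R = group.ord (add_monoid R) \<one>\<^bsub>R\<^esub>"


section \<open>Matrices over a ring and Engel maps\<close>

text \<open>
  The matrix operations are taken from the ring structure \<open>R\<close>, so that they also make sense
  for a quotient ring, whose elements are cosets.
\<close>

definition mat_mult :: "('a, 'b) ring_scheme \<Rightarrow> 'a ^ 'n ^ 'n \<Rightarrow> 'a ^ 'n ^ 'n \<Rightarrow> 'a ^ 'n ^ 'n" where
  "mat_mult R A B = (\<chi> i j. \<Oplus>\<^bsub>R\<^esub>l\<in>UNIV. A $ i $ l \<otimes>\<^bsub>R\<^esub> B $ l $ j)"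

definition mat_diff :: "('a, 'b) ring_scheme \<Rightarrow> 'a ^ 'n ^ 'n \<Rightarrow> 'a ^ 'n ^ 'n \<Rightarrow> 'a ^ 'n ^ 'n" where
  "mat_diff R A B = (\<chi> i j. A $ i $ j \<ominus>\<^bsub>R\<^esub> B $ i $ j)"

definition mat_trace :: "('a, 'b) ring_scheme \<Rightarrow> 'a ^ 'n ^ 'n \<Rightarrow> 'a" where
  "mat_trace R A = (\<Oplus>\<^bsub>R\<^esub>i\<in>UNIV. A $ i $ i)"

definition mat_commutator :: "('a, 'b) ring_scheme \<Rightarrow> 'a ^ 'n ^ 'n \<Rightarrow> 'a ^ 'n ^ 'n \<Rightarrow> 'a ^ 'n ^ 'n" where
  "mat_commutator R X Y = mat_diff R (mat_mult R X Y) (mat_mult R Y X)"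

definition sl2 :: "('a, 'b) ring_scheme \<Rightarrow> ('a ^ 2 ^ 2) set" where
  "sl2 R = {A. (\<forall>i j. A $ i $ j \<in> carrier R) \<and> mat_trace R A = \<zero>\<^bsub>R\<^esub>}"

text \<open>
  The Engel maps proper are those of index \<open>r \<ge> 1\<close>. The value \<open>X\<close> at index \<open>0\<close> is a convention
  that makes \<open>e\<^sub>1(X, Y) = XY - YX\<close> an instance of the recursion.
\<close>

primrec engel :: "('a, 'b) ring_scheme \<Rightarrow> nat \<Rightarrow> 'a ^ 2 ^ 2 \<Rightarrow> 'a ^ 2 ^ 2 \<Rightarrow> 'a ^ 2 ^ 2" where
  "engel R 0 X Y = X"
| "engel R (Suc r) X Y = mat_commutator R (engel R r X Y) Y"

lemma engel_1: "engel R 1 X Y = mat_diff R (mat_mult R X Y) (mat_mult R Y X)"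
  by (simp add: mat_commutator_def)

end

theory Submission
  imports Defs "HOL-Algebra.Ring_Divisibility" "HOL-Analysis.Cartesian_Space"
begin

text \<open>
  For traceless \<open>A\<close> and \<open>Y\<close> with \<open>tr (A Y) = 0\<close> one has \<open>[[A, Y], Y] = 4 \<delta> A\<close>, where
  \<open>\<delta> = - det Y\<close>; hence \<open>[-, Y]\<close> is bijective on the orthogonal complement of \<open>Y\<close> as soon as
  \<open>2\<close> and \<open>\<delta>\<close> are units. If \<open>A\<close> is nonzero modulo the maximal ideal, then such a \<open>Y\<close> orthogonal
  to \<open>A\<close> can be written down, because the quadratic form \<open>\<delta>\<close> does not vanish identically on a plane. Every
  other \<open>A\<close> is a multiple of such a matrix, since the powers of the maximal ideal
  intersect in zero, and the Engel maps are linear in their first argument.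
\<close>

section \<open>Local rings\<close>

text \<open>Krull's theorem: Zorn's lemma applies to the ideals that contain \<open>I\<close> and
  avoid \<open>\<one>\<close>, because both conditions survive unions of nonempty chains.\<close>

lemma (in cring) proper_ideal_le_maximalideal:
  assumes "ideal I R" and "\<one> \<notin> I"
  obtains J where "maximalideal J R" and "I \<subseteq> J"
proof -
  let ?S = "{J. ideal J R \<and> \<one> \<notin> J \<and> I \<subseteq> J}"
  have "\<exists>J\<in>?S. \<forall>K\<in>?S. J \<subseteq> K \<longrightarrow> K = J"
  proof (rule subset_Zorn)
    fix C assume C: "subset.chain ?S C"
    show "\<exists>U\<in>?S. \<forall>K\<in>C. K \<subseteq> U"
    \<comment> \<open>The union of the empty chain is not an ideal, so \<open>I\<close> itself
      serves as its upper bound.\<close>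
    proof (cases "C = {}")
      case True
      then show ?thesis using assms by blast
    next
      case False
      have "subset.chain {I. ideal I R} C"
        using C unfolding pred_on.chain_def by auto
      then have "ideal (\<Union>C) R"
        using chain_Union_is_ideal[of C] False by simp
      moreover have "\<one> \<notin> \<Union>C" "I \<subseteq> \<Union>C"
        using C False unfolding pred_on.chain_def by blast+
      ultimately show ?thesis by blast
    qed
  qed
  then obtain J where "J \<in> ?S" and max: "\<forall>K\<in>?S. J \<subseteq> K \<longrightarrow> K = J"
    by (rule bexE)
  then have J: "ideal J R" "\<one> \<notin> J" "I \<subseteq> J"
    by simp_all
  have "maximalideal J R"
  proof (rule maximalidealI)
    show "carrier R \<noteq> J" using J(2) by auto
    show "K = J \<or> K = carrier R" if K: "ideal K R" "J \<subseteq> K" for K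
    proof (cases "\<one> \<in> K")
      case True
      then show ?thesis using ideal.one_imp_carrier[OF K(1)] by simp
    next
      case False
      then have "K \<in> ?S" using K J(3) by simp
      then show ?thesis using max K(2) by simp
    qed
  qed (fact J(1))
  with J(3) that show ?thesis by blast
qed

text \<open>A nonunit generates a proper ideal; some maximal ideal contains it, and by uniqueness
  that ideal is \<open>M\<close>.\<close>

lemma (in local_ring) Units_if_notin_maximalideal:
  assumes "maximalideal M R" and x: "x \<in> carrier R" "x \<notin> M"
  shows "x \<in> Units R"
proof (rule ccontr)
  assume nonunit: "x \<notin> Units R"
  have "\<one> \<notin> PIdl x"
  proof
    assume "\<one> \<in> PIdl x"
    then obtain y where "y \<in> carrier R" "\<one> = y \<otimes> x"
      unfolding cgenideal_def by blast
    with nonunit x(1) show False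
      unfolding Units_def by (auto simp: m_comm)
  qed
  then obtain J where "maximalideal J R" "PIdl x \<subseteq> J"
    using proper_ideal_le_maximalideal cgenideal_ideal x(1) by blast
  then have "x \<in> M"
    using unique_maximal assms(1) cgenideal_self[OF x(1)] by blast
  with x(2) show False ..
qed

lemma (in ring) two_notin_if_Quot_characteristic_not_two:
  assumes "ideal I R" and "\<one> \<notin> I" and "ring_characteristic (R Quot I) \<noteq> 2"
  shows "\<one> \<oplus> \<one> \<notin> I"
proof
  assume two: "\<one> \<oplus> \<one> \<in> I"
  interpret I: ideal I R by fact
  interpret Q: ring "R Quot I" by (rule I.quotient_is_ring)
  have hom: "(+>) I \<in> ring_hom R (R Quot I)" by (rule I.rcos_ring_hom)
  have "\<one>\<^bsub>R Quot I\<^esub> \<oplus>\<^bsub>R Quot I\<^esub> \<one>\<^bsub>R Quot I\<^esub> = I +> (\<one> \<oplus> \<one>)"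
    using ring_hom_add[OF hom] ring_hom_one[OF hom] by simp
  also have "\<dots> = \<zero>\<^bsub>R Quot I\<^esub>"
    using a_rcos_zero[OF assms(1) two] by (simp add: FactRing_def)
  finally have "\<one>\<^bsub>R Quot I\<^esub> [^]\<^bsub>add_monoid (R Quot I)\<^esub> (2::nat) = \<one>\<^bsub>add_monoid (R Quot I)\<^esub>"
    by (simp add: numeral_2_eq_2)
  then have "ring_characteristic (R Quot I) dvd 2"
    unfolding ring_characteristic_def by (subst (asm) group.pow_eq_id[OF Q.a_group]) simp_all
  \<comment> \<open>The divisor 2 is excluded by hypothesis, and 0, which encodes infinite order,
    does not divide 2. Characteristic 1 would make the quotient the zero ring.\<close>
  with assms(3) have "ring_characteristic (R Quot I) = 1"
    using dvd_imp_le[of "ring_characteristic (R Quot I)" 2]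
    by (cases "ring_characteristic (R Quot I)") auto
  then have "\<one>\<^bsub>R Quot I\<^esub> = \<zero>\<^bsub>R Quot I\<^esub>"
    unfolding ring_characteristic_def by (subst (asm) group.ord_eq_1[OF Q.a_group]) simp_all
  then have "I +> \<one> = I" by (simp add: FactRing_def)
  with I.a_rcos_self[of \<one>] assms(2) show False by simp
qed

section \<open>Divisibility by powers of the uniformizer\<close>

lemma (in cring) ideal_power_is_ideal:
  assumes "ideal I R"
  shows "ideal (ideal_power R I j) R"
proof -
  interpret S: comm_monoid "ideals_set R" by (rule ideals_set_is_comm_monoid)
  show ?thesis using S.nat_pow_closed[of I j] assms by (simp add: ideals_set_def)
qed

lemma (in cring) pow_mem_ideal_power:
  assumes "ideal I R" and "x \<in> I"
  shows "x [^] j \<in> ideal_power R I j"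
proof (induction j)
  case 0
  then show ?case by (simp add: ideals_set_def nat_pow_def)
next
  case (Suc j)
  have "x [^] j \<otimes> x \<in> ideal_prod R (ideal_power R I j) I"
    using Suc assms(2) by (rule ideal_prod.prod)
  then show ?case by (simp add: ideals_set_def nat_pow_def)
qed

text \<open>This is injectivity of the canonical map into the inverse limit: an element of every
  power has the same image as \<open>\<zero>\<close>.\<close>

lemma (in cring) Inter_ideal_power_eq_zero:
  assumes "adically_complete R I" and I: "ideal I R"
    and x: "x \<in> carrier R" "\<And>j. x \<in> ideal_power R I j"
  shows "x = \<zero>"
proof -
  have "inj_on (to_adic_limit R I) (carrier R)"
    using assms(1) unfolding adically_complete_def ring_iso_def bij_betw_def by blast
  moreover have "ideal_power R I j +> y = ideal_power R I j" if "y \<in> {x, \<zero>}" for j y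
    using a_rcos_zero[OF ideal_power_is_ideal[OF I]] x(2) that
      additive_subgroup.zero_closed[OF ideal.axioms(1)[OF ideal_power_is_ideal[OF I]]] by blast
  then have "to_adic_limit R I x = to_adic_limit R I \<zero>"
    unfolding to_adic_limit_def by simp
  ultimately show ?thesis using x(1) by (simp add: inj_on_def)
qed

text \<open>The factor \<open>t\<close> is the highest power of \<open>\<pi>\<close> dividing all
  three elements, or zero if every power divides them. Quotients by \<open>t\<close> need not be
  unique, as zero divisors may occur; any choice works.\<close>

lemma (in cring) triple_eq_multiple_of_primitive:
  assumes \<pi>: "\<pi> \<in> carrier R" and M: "M = PIdl \<pi>" "\<one> \<notin> M"
    and complete: "adically_complete R M"
    and abc: "a \<in> carrier R" "b \<in> carrier R" "c \<in> carrier R"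
  obtains t a' b' c' where "t \<in> carrier R" "a' \<in> carrier R" "b' \<in> carrier R" "c' \<in> carrier R"
    "a = t \<otimes> a'" "b = t \<otimes> b'" "c = t \<otimes> c'" "\<not> {a', b', c'} \<subseteq> M"
proof -
  have ideal: "ideal M R" using cgenideal_ideal[OF \<pi>] M(1) by simp
  define P where "P j \<longleftrightarrow> (\<forall>x\<in>{a, b, c}. \<exists>x'\<in>carrier R. x = \<pi> [^] j \<otimes> x')" for j :: nat
  show ?thesis
  proof (cases "\<forall>j. P j")
    case True
    have "x = \<zero>" if x: "x \<in> {a, b, c}" for x
    proof (rule Inter_ideal_power_eq_zero[OF complete ideal])
      show "x \<in> carrier R" using x abc by blast
      fix j
      have "\<pi> [^] j \<in> ideal_power R M j"
        using pow_mem_ideal_power[OF ideal] cgenideal_self[OF \<pi>] M(1) by simp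
      then show "x \<in> ideal_power R M j"
        using True x ideal.I_r_closed[OF ideal_power_is_ideal[OF ideal]] unfolding P_def by metis
    qed
    \<comment> \<open>All three elements vanish, so \<open>t\<close> is \<open>\<zero>\<close> and
      any triple with an entry outside \<open>M\<close> will do.\<close>
    with M(2) show ?thesis
      by (intro that[of \<zero> \<one> \<zero> \<zero>]) auto
  next
    case False
    moreover have "P 0" using abc by (auto simp: P_def)
    ultimately obtain j where j: "P j" "\<not> P (Suc j)"
      by (metis nat_induct)
    from j(1) have "\<exists>a'\<in>carrier R. a = \<pi> [^] j \<otimes> a'" "\<exists>b'\<in>carrier R. b = \<pi> [^] j \<otimes> b'"
      "\<exists>c'\<in>carrier R. c = \<pi> [^] j \<otimes> c'"
      by (simp_all add: P_def)
    then obtain a' b' c' where *: "a' \<in> carrier R" "b' \<in> carrier R" "c' \<in> carrier R"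
      "a = \<pi> [^] j \<otimes> a'" "b = \<pi> [^] j \<otimes> b'" "c = \<pi> [^] j \<otimes> c'"
      by blast
    \<comment> \<open>If all three quotients lay in \<open>M\<close>, each would supply one more
      factor \<open>\<pi>\<close>, contradicting the failure of \<open>P (Suc j)\<close>.\<close>
    have "\<exists>y\<in>carrier R. \<pi> [^] j \<otimes> x = \<pi> [^] Suc j \<otimes> y" if "x \<in> M" for x
    proof -
      from that M(1) obtain y where y: "y \<in> carrier R" "x = y \<otimes> \<pi>"
        unfolding cgenideal_def by blast
      then have "\<pi> [^] j \<otimes> x = \<pi> [^] Suc j \<otimes> y"
        using \<pi> by (simp add: m_assoc m_comm[of y \<pi>])
      with y(1) show ?thesis ..
    qed
    then have "\<not> {a', b', c'} \<subseteq> M"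
      using j(2) *(4-6) unfolding P_def by simp metis
    with * \<pi> show ?thesis by (intro that[of "\<pi> [^] j" a' b' c']) auto
  qed
qed

section \<open>Traceless matrices\<close>

definition sl2_mat :: "('a, 'b) ring_scheme \<Rightarrow> 'a \<Rightarrow> 'a \<Rightarrow> 'a \<Rightarrow> 'a ^ 2 ^ 2" where
  "sl2_mat R a b c = (\<chi> i j. if i = 1 then if j = 1 then a else b
                             else if j = 1 then c else \<ominus>\<^bsub>R\<^esub> a)"

definition mat_scale :: "('a, 'b) ring_scheme \<Rightarrow> 'a \<Rightarrow> 'a ^ 'n ^ 'n \<Rightarrow> 'a ^ 'n ^ 'n" where
  "mat_scale R t A = (\<chi> i j. t \<otimes>\<^bsub>R\<^esub> A $ i $ j)"

lemma sl2_mat_nth [simp]: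
  "sl2_mat R a b c $ 1 $ 1 = a" "sl2_mat R a b c $ 1 $ 2 = b"
  "sl2_mat R a b c $ 2 $ 1 = c" "sl2_mat R a b c $ 2 $ 2 = \<ominus>\<^bsub>R\<^esub> a"
  by (simp_all add: sl2_mat_def)

context cring
begin

lemma finsum_UNIV_2:
  assumes "f \<in> (UNIV :: 2 set) \<rightarrow> carrier R"
  shows "(\<Oplus>i\<in>(UNIV :: 2 set). f i) = f 1 \<oplus> f 2"
  using assms by (simp add: UNIV_2 Pi_iff)

lemma sl2_mat_in_sl2:
  assumes "a \<in> carrier R" "b \<in> carrier R" "c \<in> carrier R"
  shows "sl2_mat R a b c \<in> sl2 R"
  using assms by (simp add: sl2_def mat_trace_def forall_2 finsum_UNIV_2 Pi_iff r_neg)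

lemma in_sl2E:
  assumes "A \<in> sl2 R"
  obtains a b c where "a \<in> carrier R" "b \<in> carrier R" "c \<in> carrier R" "A = sl2_mat R a b c"
proof -
  have A: "A $ i $ j \<in> carrier R" for i j
    using assms by (simp add: sl2_def)
  have "A $ 1 $ 1 \<oplus> A $ 2 $ 2 = \<zero>"
    using assms A by (simp add: sl2_def mat_trace_def finsum_UNIV_2 Pi_iff)
  then have "A $ 2 $ 2 = \<ominus> (A $ 1 $ 1)"
    using A by (metis a_comm minus_equality)
  then have "A = sl2_mat R (A $ 1 $ 1) (A $ 1 $ 2) (A $ 2 $ 1)"
    by (simp add: vec_eq_iff forall_2)
  with A that show ?thesis by blast
qed

text \<open>Up to the order of the entries and factors 2, the bracket is the cross product of the
  coordinate vectors. The 2 appears off the diagonal because the lower right entry is minus the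
  upper left one.\<close>

lemma mat_commutator_sl2_mat:
  assumes "a \<in> carrier R" "b \<in> carrier R" "c \<in> carrier R"
    and "x \<in> carrier R" "y \<in> carrier R" "z \<in> carrier R"
  shows "mat_commutator R (sl2_mat R a b c) (sl2_mat R x y z) =
    sl2_mat R (b \<otimes> z \<ominus> c \<otimes> y) ((\<one> \<oplus> \<one>) \<otimes> (a \<otimes> y \<ominus> b \<otimes> x)) ((\<one> \<oplus> \<one>) \<otimes> (c \<otimes> x \<ominus> a \<otimes> z))"
  unfolding vec_eq_iff forall_2
  using assms
  by (simp add: mat_commutator_def mat_diff_def mat_mult_def finsum_UNIV_2 Pi_iff forall_2)
    (intro conjI; algebra)

lemma mat_scale_sl2_mat:
  assumes "t \<in> carrier R" "a \<in> carrier R"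
  shows "mat_scale R t (sl2_mat R a b c) = sl2_mat R (t \<otimes> a) (t \<otimes> b) (t \<otimes> c)"
  using assms by (simp add: vec_eq_iff forall_2 mat_scale_def r_minus)

lemma mat_scale_in_sl2:
  assumes "t \<in> carrier R" "A \<in> sl2 R"
  shows "mat_scale R t A \<in> sl2 R"
  using assms(2) by (rule in_sl2E) (simp add: assms(1) mat_scale_sl2_mat sl2_mat_in_sl2)

lemma mat_commutator_in_sl2:
  assumes "X \<in> sl2 R" "Y \<in> sl2 R"
  shows "mat_commutator R X Y \<in> sl2 R"
  using assms(1)
proof (rule in_sl2E)
  fix a b c assume X: "a \<in> carrier R" "b \<in> carrier R" "c \<in> carrier R" "X = sl2_mat R a b c"
  from assms(2) show ?thesis
    by (rule in_sl2E) (simp add: X mat_commutator_sl2_mat sl2_mat_in_sl2)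
qed

lemma mat_commutator_scale:
  assumes t: "t \<in> carrier R" and XY: "X \<in> sl2 R" "Y \<in> sl2 R"
  shows "mat_commutator R (mat_scale R t X) Y = mat_scale R t (mat_commutator R X Y)"
proof -
  from XY(1) obtain a b c where
    X: "a \<in> carrier R" "b \<in> carrier R" "c \<in> carrier R" "X = sl2_mat R a b c"
    by (rule in_sl2E)
  from XY(2) obtain x y z where
    Y: "x \<in> carrier R" "y \<in> carrier R" "z \<in> carrier R" "Y = sl2_mat R x y z"
    by (rule in_sl2E)
  have "t \<otimes> b \<otimes> z \<ominus> t \<otimes> c \<otimes> y = t \<otimes> (b \<otimes> z \<ominus> c \<otimes> y)"
    "(\<one> \<oplus> \<one>) \<otimes> (t \<otimes> a \<otimes> y \<ominus> t \<otimes> b \<otimes> x) = t \<otimes> ((\<one> \<oplus> \<one>) \<otimes> (a \<otimes> y \<ominus> b \<otimes> x))"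
    "(\<one> \<oplus> \<one>) \<otimes> (t \<otimes> c \<otimes> x \<ominus> t \<otimes> a \<otimes> z) = t \<otimes> ((\<one> \<oplus> \<one>) \<otimes> (c \<otimes> x \<ominus> a \<otimes> z))"
    using t X Y(1-3) by algebra+
  then show ?thesis
    using t X Y by (simp add: mat_scale_sl2_mat mat_commutator_sl2_mat)
qed

lemma engel_in_sl2:
  assumes "X \<in> sl2 R" "Y \<in> sl2 R"
  shows "engel R n X Y \<in> sl2 R"
  by (induction n) (simp_all add: assms mat_commutator_in_sl2)

text \<open>With \<open>Y\<close> fixed, a preimage of a primitive matrix can be rescaled to a
  preimage of any multiple of it.\<close>

lemma engel_scale:
  assumes "t \<in> carrier R" "X \<in> sl2 R" "Y \<in> sl2 R"
  shows "engel R n (mat_scale R t X) Y = mat_scale R t (engel R n X Y)"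
  by (induction n) (simp_all add: assms mat_commutator_scale engel_in_sl2)

section \<open>The commutator on an orthogonal complement\<close>

text \<open>
  In coordinates \<open>tr (A Y) = 2ax + bz + cy\<close> and \<open>- det Y = x\<^sup>2 + yz\<close>, and the preimage below
  is \<open>[A, Y] / (4 (x\<^sup>2 + yz))\<close>.
\<close>

lemma mat_commutator_onto_orthogonal:
  assumes abc: "a \<in> carrier R" "b \<in> carrier R" "c \<in> carrier R"
    and xyz: "x \<in> carrier R" "y \<in> carrier R" "z \<in> carrier R"
    and orth: "(\<one> \<oplus> \<one>) \<otimes> (a \<otimes> x) \<oplus> b \<otimes> z \<oplus> c \<otimes> y = \<zero>"
    and units: "\<one> \<oplus> \<one> \<in> Units R" "x \<otimes> x \<oplus> y \<otimes> z \<in> Units R"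
  obtains a' b' c' where "a' \<in> carrier R" "b' \<in> carrier R" "c' \<in> carrier R"
    "(\<one> \<oplus> \<one>) \<otimes> (a' \<otimes> x) \<oplus> b' \<otimes> z \<oplus> c' \<otimes> y = \<zero>"
    "mat_commutator R (sl2_mat R a' b' c') (sl2_mat R x y z) = sl2_mat R a b c"
proof -
  define w where "w = \<one> \<oplus> \<one>"
  define d where "d = x \<otimes> x \<oplus> y \<otimes> z"
  \<comment> \<open>\<open>s\<close> is the inverse of \<open>4 \<delta>\<close>, and
    \<open>[A, Y]\<close> has coordinates \<open>p\<close>, \<open>w \<otimes> q\<close>,
    \<open>w \<otimes> r\<close>; the witness is \<open>s\<close> times this bracket.\<close>
  define s where "s = inv (w \<otimes> w \<otimes> d)"
  define p where "p = b \<otimes> z \<ominus> c \<otimes> y"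
  define q where "q = a \<otimes> y \<ominus> b \<otimes> x"
  define r where "r = c \<otimes> x \<ominus> a \<otimes> z"
  have "w \<otimes> w \<otimes> d \<in> Units R" using units by (simp add: w_def d_def)
  then have s: "s \<in> carrier R" "s \<otimes> (w \<otimes> w \<otimes> d) = \<one>" unfolding s_def by simp_all
  have wd: "w \<in> carrier R" "d \<in> carrier R" using xyz by (simp_all add: w_def d_def)
  have pqr: "p \<in> carrier R" "q \<in> carrier R" "r \<in> carrier R"
    using abc xyz by (simp_all add: p_def q_def r_def)
  have cancel: "s \<otimes> (w \<otimes> e) = v" if "e = w \<otimes> (v \<otimes> d)" "v \<in> carrier R" for e v
  proof -
    have "s \<otimes> (w \<otimes> e) = s \<otimes> (w \<otimes> w \<otimes> d) \<otimes> v"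
      unfolding that(1) using s(1) wd that(2) by (simp add: m_ac)
    with s(2) that(2) show ?thesis by simp
  qed
  \<comment> \<open>The left sides of this identity and the two analogous ones below are the
    coordinates of \<open>[[A, Y], Y]\<close> with one factor 2 removed. They differ from those of
    \<open>2 \<delta> A\<close> by multiples of \<open>tr (A Y)\<close>, which \<open>orth\<close>
    makes zero.\<close>
  have "q \<otimes> z \<ominus> r \<otimes> y = w \<otimes> (a \<otimes> d) \<ominus> x \<otimes> (w \<otimes> (a \<otimes> x) \<oplus> b \<otimes> z \<oplus> c \<otimes> y)"
    unfolding q_def r_def w_def d_def using abc xyz by algebra
  then have e1: "q \<otimes> z \<ominus> r \<otimes> y = w \<otimes> (a \<otimes> d)"
    using orth abc xyz wd by (simp add: w_def a_minus_def)
  have "p \<otimes> y \<ominus> w \<otimes> q \<otimes> x = w \<otimes> (b \<otimes> d) \<ominus> y \<otimes> (w \<otimes> (a \<otimes> x) \<oplus> b \<otimes> z \<oplus> c \<otimes> y)"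
    unfolding p_def q_def w_def d_def using abc xyz by algebra
  then have e2: "p \<otimes> y \<ominus> w \<otimes> q \<otimes> x = w \<otimes> (b \<otimes> d)"
    using orth abc xyz wd by (simp add: w_def a_minus_def)
  have "w \<otimes> r \<otimes> x \<ominus> p \<otimes> z = w \<otimes> (c \<otimes> d) \<ominus> z \<otimes> (w \<otimes> (a \<otimes> x) \<oplus> b \<otimes> z \<oplus> c \<otimes> y)"
    unfolding p_def r_def w_def d_def using abc xyz by algebra
  then have e3: "w \<otimes> r \<otimes> x \<ominus> p \<otimes> z = w \<otimes> (c \<otimes> d)"
    using orth abc xyz wd by (simp add: w_def a_minus_def)
  have "s \<otimes> (w \<otimes> q) \<otimes> z \<ominus> s \<otimes> (w \<otimes> r) \<otimes> y = s \<otimes> (w \<otimes> (q \<otimes> z \<ominus> r \<otimes> y))"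
    using s(1) wd pqr xyz by algebra
  with cancel[OF e1 abc(1)] have 1: "s \<otimes> (w \<otimes> q) \<otimes> z \<ominus> s \<otimes> (w \<otimes> r) \<otimes> y = a" by simp
  have "w \<otimes> (s \<otimes> p \<otimes> y \<ominus> s \<otimes> (w \<otimes> q) \<otimes> x) = s \<otimes> (w \<otimes> (p \<otimes> y \<ominus> w \<otimes> q \<otimes> x))"
    using s(1) wd pqr xyz by algebra
  with cancel[OF e2 abc(2)] have 2: "w \<otimes> (s \<otimes> p \<otimes> y \<ominus> s \<otimes> (w \<otimes> q) \<otimes> x) = b" by simp
  have "w \<otimes> (s \<otimes> (w \<otimes> r) \<otimes> x \<ominus> s \<otimes> p \<otimes> z) = s \<otimes> (w \<otimes> (w \<otimes> r \<otimes> x \<ominus> p \<otimes> z))"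
    using s(1) wd pqr xyz by algebra
  with cancel[OF e3 abc(3)] have 3: "w \<otimes> (s \<otimes> (w \<otimes> r) \<otimes> x \<ominus> s \<otimes> p \<otimes> z) = c" by simp
  \<comment> \<open>\<open>tr ([A, Y] Y) = 0\<close> holds identically, so the preimage is again
    orthogonal to \<open>Y\<close> and the construction can be iterated.\<close>
  have "p \<otimes> x \<oplus> q \<otimes> z \<oplus> r \<otimes> y = \<zero>"
    unfolding p_def q_def r_def using abc xyz by algebra
  moreover have "w \<otimes> (s \<otimes> p \<otimes> x) \<oplus> s \<otimes> (w \<otimes> q) \<otimes> z \<oplus> s \<otimes> (w \<otimes> r) \<otimes> y =
      s \<otimes> (w \<otimes> (p \<otimes> x \<oplus> q \<otimes> z \<oplus> r \<otimes> y))"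
    using s(1) wd pqr xyz by algebra
  ultimately have 4: "w \<otimes> (s \<otimes> p \<otimes> x) \<oplus> s \<otimes> (w \<otimes> q) \<otimes> z \<oplus> s \<otimes> (w \<otimes> r) \<otimes> y = \<zero>"
    using s(1) wd by simp
  show ?thesis
  proof (rule that)
    show "(\<one> \<oplus> \<one>) \<otimes> (s \<otimes> p \<otimes> x) \<oplus> s \<otimes> (w \<otimes> q) \<otimes> z \<oplus> s \<otimes> (w \<otimes> r) \<otimes> y = \<zero>"
      using 4 unfolding w_def .
    show "mat_commutator R (sl2_mat R (s \<otimes> p) (s \<otimes> (w \<otimes> q)) (s \<otimes> (w \<otimes> r))) (sl2_mat R x y z) =
        sl2_mat R a b c"
      using s(1) wd pqr xyz 1 2 3 by (simp add: mat_commutator_sl2_mat flip: w_def)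
  qed (use s(1) wd pqr in simp_all)
qed

text \<open>The recursion applies its last bracket outermost, so that bracket is inverted first. Its
  preimage stays in the complement of the same \<open>Y\<close>, where the induction hypothesis
  applies; hence the target varies in the induction while \<open>Y\<close> is fixed.\<close>

lemma engel_onto_orthogonal:
  assumes xyz: "x \<in> carrier R" "y \<in> carrier R" "z \<in> carrier R"
    and units: "\<one> \<oplus> \<one> \<in> Units R" "x \<otimes> x \<oplus> y \<otimes> z \<in> Units R"
    and "a \<in> carrier R" "b \<in> carrier R" "c \<in> carrier R"
    and "(\<one> \<oplus> \<one>) \<otimes> (a \<otimes> x) \<oplus> b \<otimes> z \<oplus> c \<otimes> y = \<zero>"
  shows "\<exists>X\<in>sl2 R. engel R n X (sl2_mat R x y z) = sl2_mat R a b c"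
  using assms(6-9)
proof (induction n arbitrary: a b c)
  case 0
  then show ?case by (auto intro: sl2_mat_in_sl2)
next
  case (Suc n)
  obtain a' b' c' where "a' \<in> carrier R" "b' \<in> carrier R" "c' \<in> carrier R"
    "(\<one> \<oplus> \<one>) \<otimes> (a' \<otimes> x) \<oplus> b' \<otimes> z \<oplus> c' \<otimes> y = \<zero>"
    and *: "mat_commutator R (sl2_mat R a' b' c') (sl2_mat R x y z) = sl2_mat R a b c"
    using Suc.prems(1-3) xyz Suc.prems(4) units by (rule mat_commutator_onto_orthogonal)
  with Suc.IH[of a' b' c'] obtain X where
    "X \<in> sl2 R" "engel R n X (sl2_mat R x y z) = sl2_mat R a' b' c'"
    by blast
  with * show ?case by (intro bexI[of _ X]) simp_all
qed

end

text \<open>The triples \<open>(x, y, z)\<close> equal to \<open>(b, 0, -2a)\<close>,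
  \<open>(c, -2a, 0)\<close> and minus their sum all satisfy the orthogonality equation. The form
  takes on them the values \<open>b^2\<close>, \<open>c^2\<close> and
  \<open>(b + c)^2 + 4 a^2\<close>, and primitivity makes one of these a unit.\<close>

lemma (in local_ring) exists_nonsingular_orthogonal:
  assumes M: "maximalideal M R" and two: "\<one> \<oplus> \<one> \<in> Units R"
    and abc: "a \<in> carrier R" "b \<in> carrier R" "c \<in> carrier R" "\<not> {a, b, c} \<subseteq> M"
  obtains x y z where "x \<in> carrier R" "y \<in> carrier R" "z \<in> carrier R"
    "(\<one> \<oplus> \<one>) \<otimes> (a \<otimes> x) \<oplus> b \<otimes> z \<oplus> c \<otimes> y = \<zero>" "x \<otimes> x \<oplus> y \<otimes> z \<in> Units R"
proof -
  interpret M: maximalideal M R by fact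
  let ?a = "(\<one> \<oplus> \<one>) \<otimes> a"
  have unit: "r \<in> Units R" if "r \<in> carrier R" "r \<notin> M" for r
    using M that by (rule Units_if_notin_maximalideal)
  consider "b \<in> Units R" | "c \<in> Units R" | "b \<in> M" "c \<in> M" "a \<in> Units R"
    using abc unit by blast
  then show ?thesis
  proof cases
    case 1
    have "(\<one> \<oplus> \<one>) \<otimes> (a \<otimes> b) \<oplus> b \<otimes> \<ominus> ?a \<oplus> c \<otimes> \<zero> = \<zero>"
      using abc(1-3) by algebra
    then show ?thesis
      using 1 abc by (intro that[of b \<zero> "\<ominus> ?a"]) auto
  next
    case 2
    have "(\<one> \<oplus> \<one>) \<otimes> (a \<otimes> c) \<oplus> b \<otimes> \<zero> \<oplus> c \<otimes> \<ominus> ?a = \<zero>"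
      using abc(1-3) by algebra
    then show ?thesis
      using 2 abc by (intro that[of c "\<ominus> ?a" \<zero>]) auto
  next
    case 3
    let ?x = "\<ominus> (b \<oplus> c)"
    have orth: "(\<one> \<oplus> \<one>) \<otimes> (a \<otimes> ?x) \<oplus> b \<otimes> ?a \<oplus> c \<otimes> ?a = \<zero>"
      using abc(1-3) by algebra
    \<comment> \<open>Modulo \<open>M\<close> the value is \<open>4 a^2\<close>, since
      \<open>b\<close> and \<open>c\<close> lie in \<open>M\<close>. Membership in \<open>M\<close>
      would thus put the unit \<open>4 a^2\<close> into \<open>M\<close>.\<close>
    have "?x \<otimes> ?x \<oplus> ?a \<otimes> ?a \<notin> M"
    proof
      assume *: "?x \<otimes> ?x \<oplus> ?a \<otimes> ?a \<in> M"
      have xx: "?x \<otimes> ?x \<in> M"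
        using 3 abc by (intro M.I_l_closed) auto
      have "(?x \<otimes> ?x \<oplus> ?a \<otimes> ?a) \<oplus> \<ominus> (?x \<otimes> ?x) \<in> M"
        by (rule M.a_closed[OF * M.a_inv_closed[OF xx]])
      moreover have "(?x \<otimes> ?x \<oplus> ?a \<otimes> ?a) \<oplus> \<ominus> (?x \<otimes> ?x) = ?a \<otimes> ?a"
        using abc(1-3) by algebra
      moreover have aa: "?a \<otimes> ?a \<in> Units R" using two 3(3) by simp
      ultimately have "inv (?a \<otimes> ?a) \<otimes> (?a \<otimes> ?a) \<in> M"
        by (metis M.I_l_closed Units_inv_closed)
      with aa have "\<one> \<in> M" by simp
      with M.one_imp_carrier M.I_notcarr show False by blast
    qed
    then have "?x \<otimes> ?x \<oplus> ?a \<otimes> ?a \<in> Units R"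
      using abc by (intro unit) auto
    with orth show ?thesis
      using abc by (intro that[of ?x ?a ?a]) auto
  qed
qed

section \<open>Preimages of arbitrary traceless matrices\<close>

theorem corollary4p7:
  fixes \<O> :: "('a, 'b) ring_scheme" and M :: "'a set" and \<pi> :: 'a and m :: nat
  assumes "local_ring \<O>" and "principal_ideal_ring \<O>"
    and "maximalideal M \<O>"
    and "\<pi> \<in> carrier \<O>" and "M = PIdl\<^bsub>\<O>\<^esub> \<pi>"
    and "adically_complete \<O> M"
    and "ring_characteristic (\<O> Quot M) \<noteq> 2"
    and "m \<ge> 1"
    and "(\<lambda>(X, Y). engel (\<O> Quot M) (m + 1) X Y) ` (sl2 (\<O> Quot M) \<times> sl2 (\<O> Quot M))
           = sl2 (\<O> Quot M)"
  shows "(\<lambda>(X, Y). engel \<O> (m + 1) X Y) ` (sl2 \<O> \<times> sl2 \<O>) = sl2 \<O>"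
proof -
  interpret local_ring \<O> by fact
  interpret M: maximalideal M \<O> by fact
  have one: "\<one>\<^bsub>\<O>\<^esub> \<notin> M"
    using M.one_imp_carrier M.I_notcarr by blast
  have "\<one>\<^bsub>\<O>\<^esub> \<oplus>\<^bsub>\<O>\<^esub> \<one>\<^bsub>\<O>\<^esub> \<notin> M"
    using M.is_ideal one assms(7) by (rule two_notin_if_Quot_characteristic_not_two)
  then have two: "\<one>\<^bsub>\<O>\<^esub> \<oplus>\<^bsub>\<O>\<^esub> \<one>\<^bsub>\<O>\<^esub> \<in> Units \<O>"
    using assms(3) by (intro Units_if_notin_maximalideal) auto
  have "\<exists>X\<in>sl2 \<O>. \<exists>Y\<in>sl2 \<O>. A = engel \<O> (m + 1) X Y" if "A \<in> sl2 \<O>" for A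
  proof -
    from that obtain a b c where
      abc: "a \<in> carrier \<O>" "b \<in> carrier \<O>" "c \<in> carrier \<O>" and A: "A = sl2_mat \<O> a b c"
      by (rule in_sl2E)
    \<comment> \<open>The matrix \<open>Y\<close> is chosen for the primitive part of
      \<open>A\<close>; the common factor \<open>t\<close> is put back into \<open>X\<close> at the
      end.\<close>
    obtain t a' b' c' where t: "t \<in> carrier \<O>"
      and abc': "a' \<in> carrier \<O>" "b' \<in> carrier \<O>" "c' \<in> carrier \<O>" "\<not> {a', b', c'} \<subseteq> M"
      and eq: "a = t \<otimes>\<^bsub>\<O>\<^esub> a'" "b = t \<otimes>\<^bsub>\<O>\<^esub> b'" "c = t \<otimes>\<^bsub>\<O>\<^esub> c'"
      using assms(4,5) one assms(6) abc by (rule triple_eq_multiple_of_primitive)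
    obtain x y z where xyz: "x \<in> carrier \<O>" "y \<in> carrier \<O>" "z \<in> carrier \<O>"
      and orth: "(\<one>\<^bsub>\<O>\<^esub> \<oplus>\<^bsub>\<O>\<^esub> \<one>\<^bsub>\<O>\<^esub>) \<otimes>\<^bsub>\<O>\<^esub> (a' \<otimes>\<^bsub>\<O>\<^esub> x) \<oplus>\<^bsub>\<O>\<^esub> b' \<otimes>\<^bsub>\<O>\<^esub> z \<oplus>\<^bsub>\<O>\<^esub> c' \<otimes>\<^bsub>\<O>\<^esub> y = \<zero>\<^bsub>\<O>\<^esub>"
      and unit: "x \<otimes>\<^bsub>\<O>\<^esub> x \<oplus>\<^bsub>\<O>\<^esub> y \<otimes>\<^bsub>\<O>\<^esub> z \<in> Units \<O>"
      using assms(3) two abc' by (rule exists_nonsingular_orthogonal)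
    have Y: "sl2_mat \<O> x y z \<in> sl2 \<O>"
      using xyz by (rule sl2_mat_in_sl2)
    obtain X where X: "X \<in> sl2 \<O>" "engel \<O> (m + 1) X (sl2_mat \<O> x y z) = sl2_mat \<O> a' b' c'"
      using engel_onto_orthogonal[OF xyz two unit abc'(1-3) orth] by blast
    have "engel \<O> (m + 1) (mat_scale \<O> t X) (sl2_mat \<O> x y z) = A"
      using engel_scale[OF t X(1) Y] X(2) mat_scale_sl2_mat[OF t abc'(1)] A eq by metis
    with mat_scale_in_sl2[OF t X(1)] Y show ?thesis by metis
  qed
  then show ?thesis
    \<comment> \<open>The reverse inclusion holds because brackets of traceless matrices are
      traceless. The recursion is kept folded so that \<open>engel_in_sl2\<close> matches.\<close>
    by (auto intro: engel_in_sl2 simp del: engel.simps)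
qed

end
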